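(* Stable $k$-positive continuous-time LTI systems are in general not diagonally stable. Specifically, let $$A=\begin{bmatrix}-21&11&-14\\18&-19&37\\-49&21&-33\end{bmatrix}\in\mathbb{R}^{3\times 3}.$$ Then $A$ is Hurwitz (all its eigenvalues have negative real part) and the continuous-time LTI system $\dot x=Ax$ is strongly $2$-positive, but there is no diagonal matrix $D\in\mathbb{R}^{3\times 3}$ with positive diagonal entries such that $DA+A^TD\prec 0$.
   Context: For a symmetric matrix $P$, $P\prec 0$ means that $P$ is negative-definite. For $x\in\mathbb{R}^n$, $x\neq 0$, let $s^-(x)$ be the number of sign variations in $x$ after deleting all its zero entries, and set $s^-(0)=0$. Let $s^+(x)$ be the maximal possible number of sign variations in $x$ after each zero entry is replaced by either $1$ or $-1$. For $k\in\{1,\dots,n\}$ let $P^k_-=\{x\in\mathbb{R}^n: s^-(x)\le k-1\}$ and $P^k_+=\{x\in\mathbb{R}^n: s^+(x)\le k-1\}$. The continuous-time LTI system $\dot x=Ax$ is called strongly $k$-positive if $\exp(At)(P^k_-\setminus\{0\})\subseteq P^k_+$ for all $t>0$. *)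

theory Defs
  imports "HOL-Analysis.Analysis" "Jordan_Normal_Form.Char_Poly"
begin

no_notation Finite_Cartesian_Product.vec_nth (infixl "$" 90)
no_notation Inner_Product.real_inner_class.inner (infix "\<bullet>" 70)

definition sign_variations :: "real list \<Rightarrow> nat" where
  "sign_variations xs = card {i. Suc i < length xs \<and> xs ! i * xs ! Suc i < 0}"

text \<open>For the zero vector the filtered list is empty, so the value is \<open>0\<close>.\<close>

definition s_minus :: "real vec \<Rightarrow> nat" where
  "s_minus x = sign_variations (filter (\<lambda>a. a \<noteq> 0) (list_of_vec x))"

definition zero_fillings :: "real vec \<Rightarrow> real vec set" where
  "zero_fillings x =
     {y \<in> carrier_vec (dim_vec x).
        \<forall>i<dim_vec x. if x $ i = 0 then y $ i \<in> {1, -1} else y $ i = x $ i}"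

definition s_plus :: "real vec \<Rightarrow> nat" where
  "s_plus x = Max ((\<lambda>y. sign_variations (list_of_vec y)) ` zero_fillings x)"

definition P_minus :: "nat \<Rightarrow> nat \<Rightarrow> real vec set" where
  "P_minus n k = {x \<in> carrier_vec n. s_minus x \<le> k - 1}"

definition P_plus :: "nat \<Rightarrow> nat \<Rightarrow> real vec set" where
  "P_plus n k = {x \<in> carrier_vec n. s_plus x \<le> k - 1}"

text \<open>The exponential power series, summed entrywise (square matrices only); it converges for
  every square matrix. The type of matrices has no topology, so the overloaded \<open>exp\<close> does not
  apply.\<close>

definition mat_exp :: "real mat \<Rightarrow> real mat" where
  "mat_exp A = mat (dim_row A) (dim_row A) (\<lambda>(i, j). \<Sum>m. (A ^\<^sub>m m) $$ (i, j) / fact m)"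

definition strongly_k_positive :: "nat \<Rightarrow> nat \<Rightarrow> real mat \<Rightarrow> bool" where
  "strongly_k_positive n k A \<longleftrightarrow>
     A \<in> carrier_mat n n \<and> 1 \<le> k \<and> k \<le> n \<and>
     (\<forall>t>0. (\<lambda>x. mat_exp (t \<cdot>\<^sub>m A) *\<^sub>v x) ` (P_minus n k - {0\<^sub>v n}) \<subseteq> P_plus n k)"

definition hurwitz :: "real mat \<Rightarrow> bool" where
  "hurwitz A \<longleftrightarrow>
     square_mat A \<and> (\<forall>z. eigenvalue (map_mat complex_of_real A) z \<longrightarrow> Re z < 0)"

definition negative_definite :: "real mat \<Rightarrow> bool" where
  "negative_definite P \<longleftrightarrow>
     square_mat P \<and> P\<^sup>T = P \<and>
     (\<forall>x \<in> carrier_vec (dim_row P). x \<noteq> 0\<^sub>v (dim_row P) \<longrightarrow> x \<bullet> (P *\<^sub>v x) < 0)"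

definition A_ex :: "real mat" where
  "A_ex = mat_of_rows_list 3
     [[-21,  11, -14],
      [ 18, -19,  37],
      [-49,  21, -33]]"

end

(* With S = diag(1, -1, 1), the matrix -A equals S B S for an entrywise positive B, so
   exp(-tA) = S exp(tB) S with exp(tB) entrywise positive. Hence if y = exp(tA) x is nonzero and
   has weakly alternating signs, then x = exp(-tA) y has strictly alternating signs; contrapositively
   s^-(x) <= 1 forces s^+(y) <= 1. *)
theory Submission
  imports Defs
begin

section \<open>Convergence of the exponential series\<close>

text \<open>Multiplying by \<open>A\<close> sums n products, each with a factor of size at most c,
  so every step costs a factor n c. This gives a geometric majorant for the exponential
  series.\<close>

lemma pow_mat_entry_abs_le:
  fixes A :: "real mat"
  assumes A: "A \<in> carrier_mat n n"
    and le: "\<And>i j. i < n \<Longrightarrow> j < n \<Longrightarrow> \<bar>A $$ (i, j)\<bar> \<le> c"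
    and "i < n" "j < n"
  shows "\<bar>(A ^\<^sub>m m) $$ (i, j)\<bar> \<le> (real n * c) ^ m"
  using assms(3,4)
proof (induction m arbitrary: i j)
  case 0
  then show ?case using A by auto
next
  case (Suc m)
  have Am: "A ^\<^sub>m m \<in> carrier_mat n n" using A by auto
  have "(A ^\<^sub>m Suc m) $$ (i, j) = (\<Sum>k<n. (A ^\<^sub>m m) $$ (i, k) * A $$ (k, j))"
    using Suc.prems A Am by (simp add: scalar_prod_def lessThan_atLeast0)
  also have "\<bar>\<dots>\<bar> \<le> (\<Sum>k<n. \<bar>(A ^\<^sub>m m) $$ (i, k)\<bar> * \<bar>A $$ (k, j)\<bar>)"
    by (simp add: sum_abs flip: abs_mult)
  also have "\<dots> \<le> (\<Sum>k<n. (real n * c) ^ m * c)"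
    using Suc le by (intro sum_mono mult_mono) (auto intro: order_trans[OF abs_ge_zero])
  also have "\<dots> = (real n * c) ^ Suc m" by simp
  finally show ?case .
qed

text \<open>Comparison with the scalar series of exp(n c). Absolute convergence is what the Cauchy
  product below requires.\<close>

lemma summable_norm_mat_exp_entry:
  fixes A :: "real mat"
  assumes A: "A \<in> carrier_mat n n" and ij: "i < n" "j < n"
  shows "summable (\<lambda>m. norm ((A ^\<^sub>m m) $$ (i, j) / fact m))"
proof -
  \<comment> \<open>The sum of all absolute entries serves as a uniform bound on them.\<close>
  define c where "c = (\<Sum>p\<in>{..<n} \<times> {..<n}. \<bar>A $$ p\<bar>)"
  have c: "\<bar>A $$ (i, j)\<bar> \<le> c" if "i < n" "j < n" for i j
    unfolding c_def using that by (intro member_le_sum) auto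
  show ?thesis
  proof (rule summable_comparison_test')
    show "summable (\<lambda>m. inverse (fact m) * (real n * c) ^ m)"
      by (rule summable_exp)
    show "norm (norm ((A ^\<^sub>m m) $$ (i, j) / fact m)) \<le> inverse (fact m) * (real n * c) ^ m"
      if "m \<ge> 0" for m
      using pow_mat_entry_abs_le[OF A c ij, of m] by (simp add: divide_simps)
  qed
qed

lemma mat_exp_carrier [simp]: "A \<in> carrier_mat n n \<Longrightarrow> mat_exp A \<in> carrier_mat n n"
  by (auto simp: mat_exp_def)

section \<open>Inverting the matrix exponential\<close>

lemma pow_mat_uminus:
  fixes A :: "real mat"
  assumes A: "A \<in> carrier_mat n n"
  shows "(- A) ^\<^sub>m m = (- 1) ^ m \<cdot>\<^sub>m (A ^\<^sub>m m)"
proof (induction m)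
  case 0
  then show ?case by auto
next
  case (Suc m)
  have Am: "A ^\<^sub>m m \<in> carrier_mat n n" using A by auto
  show ?case
    using Suc A Am by (intro eq_matI) (auto simp: scalar_prod_def sum_distrib_left sum_negf ac_simps)
qed

lemma pow_mat_add:
  fixes A :: "'a :: semiring_1 mat"
  assumes A: "A \<in> carrier_mat n n"
  shows "A ^\<^sub>m (k + l) = A ^\<^sub>m k * A ^\<^sub>m l"
proof (induction l)
  case 0
  then show ?case using A by auto
next
  case (Suc l)
  have "A ^\<^sub>m k \<in> carrier_mat n n" "A ^\<^sub>m l \<in> carrier_mat n n" using A by auto
  then have "A ^\<^sub>m k * A ^\<^sub>m l * A = A ^\<^sub>m k * (A ^\<^sub>m l * A)"
    using A by (rule assoc_mult_mat)
  then show ?case using Suc by simp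
qed

text \<open>Each entry of the product is a sum over k of Cauchy products of scalar series. The part
  of degree N is the entry of A^N / N! times the alternating sum of the binomials C(N, m), so only N
  = 0 survives.\<close>

lemma mat_exp_uminus_mult:
  fixes A :: "real mat"
  assumes A: "A \<in> carrier_mat n n"
  shows "mat_exp (- A) * mat_exp A = 1\<^sub>m n"
proof (rule eq_matI)
  fix i j assume "i < dim_row (1\<^sub>m n :: real mat)" "j < dim_col (1\<^sub>m n :: real mat)"
  then have ij: "i < n" "j < n" by auto
  have mA: "- A \<in> carrier_mat n n" using A by auto
  define a where "a k m = ((- A) ^\<^sub>m m) $$ (i, k) / fact m" for k m
  define b where "b k m = (A ^\<^sub>m m) $$ (k, j) / fact m" for k m
  have coeff: "(\<Sum>k<n. \<Sum>m\<le>N. a k m * b k (N - m)) = (if N = 0 then 1\<^sub>m n $$ (i, j) else 0)" for N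
  proof -
    \<comment> \<open>Summing over k recombines A^m A^(N-m) into A^N, and 1 / (m! (N-m)!) = C(N, m)
      / N!.\<close>
    have "(\<Sum>k<n. a k m * b k (N - m)) =
        (A ^\<^sub>m N) $$ (i, j) / fact N * ((- 1) ^ m * of_nat (N choose m))" if "m \<le> N" for m
    proof -
      have "A ^\<^sub>m N = A ^\<^sub>m m * A ^\<^sub>m (N - m)"
        using pow_mat_add[OF A, of m "N - m"] that by simp
      then have "(A ^\<^sub>m N) $$ (i, j) = (\<Sum>k<n. (A ^\<^sub>m m) $$ (i, k) * (A ^\<^sub>m (N - m)) $$ (k, j))"
        using ij A by (simp add: scalar_prod_def lessThan_atLeast0)
      then have *: "(A ^\<^sub>m N) $$ (i, j) / fact N * ((- 1) ^ m * of_nat (N choose m)) =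
        (\<Sum>k<n. (A ^\<^sub>m m) $$ (i, k) * (A ^\<^sub>m (N - m)) $$ (k, j) *
           ((- 1) ^ m * of_nat (N choose m) / fact N))"
        by (simp only: sum_distrib_right sum_divide_distrib times_divide_eq_left times_divide_eq_right)
      show ?thesis unfolding *
      proof (rule sum.cong[OF refl])
        fix k assume "k \<in> {..<n}"
        then have "((- A) ^\<^sub>m m) $$ (i, k) = (- 1) ^ m * (A ^\<^sub>m m) $$ (i, k)"
          using ij A by (simp add: pow_mat_uminus[OF A])
        then show "a k m * b k (N - m) = (A ^\<^sub>m m) $$ (i, k) * (A ^\<^sub>m (N - m)) $$ (k, j) *
           ((- 1) ^ m * of_nat (N choose m) / fact N)"
          using that by (simp add: a_def b_def binomial_fact)
      qed
    qed
    then have "(\<Sum>k<n. \<Sum>m\<le>N. a k m * b k (N - m)) =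
        (A ^\<^sub>m N) $$ (i, j) / fact N * (\<Sum>m\<le>N. (- 1) ^ m * of_nat (N choose m))"
      by (subst sum.swap) (simp add: sum_distrib_left)
    then show ?thesis
      using A choose_alternating_sum[of N, where 'a = real] by (cases "N = 0") auto
  qed
  have "(\<lambda>N. \<Sum>k<n. \<Sum>m\<le>N. a k m * b k (N - m)) sums (\<Sum>k<n. suminf (a k) * suminf (b k))"
    using ij A mA unfolding a_def b_def
    by (intro sums_sum Cauchy_product_sums summable_norm_mat_exp_entry) auto
  moreover have "(\<lambda>N. if N = 0 then 1\<^sub>m n $$ (i, j) else 0 :: real) sums 1\<^sub>m n $$ (i, j)"
    by (rule sums_single)
  ultimately have "(\<Sum>k<n. suminf (a k) * suminf (b k)) = 1\<^sub>m n $$ (i, j)"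
    unfolding coeff by (rule sums_unique2)
  then show "(mat_exp (- A) * mat_exp A) $$ (i, j) = 1\<^sub>m n $$ (i, j)"
    using ij A by (simp add: mat_exp_def a_def[abs_def] b_def[abs_def] scalar_prod_def lessThan_atLeast0)
qed (use A in \<open>auto simp: mat_exp_def\<close>)

section \<open>Exponentials with a prescribed sign pattern\<close>

text \<open>Conjugation by S = diag(s) commutes with powers because S S = 1, so all terms of the
  series inherit the pattern of \<open>A\<close>, except the identity term, which vanishes off the
  diagonal.\<close>

lemma mat_exp_sign_pattern_pos:
  fixes A :: "real mat" and s :: "nat \<Rightarrow> real"
  assumes A: "A \<in> carrier_mat n n"
    and s: "\<And>i. i < n \<Longrightarrow> s i * s i = 1"
    and pos: "\<And>i j. i < n \<Longrightarrow> j < n \<Longrightarrow> s i * A $$ (i, j) * s j > 0"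
    and ij: "i < n" "j < n"
  shows "s i * mat_exp A $$ (i, j) * s j > 0"
proof -
  have Suc_pos: "s i * (A ^\<^sub>m Suc m) $$ (i, j) * s j > 0" if "i < n" "j < n" for i j m
    using that
  proof (induction m arbitrary: i j)
    case 0
    then show ?case using pos A by auto
  next
    case (Suc m)
    have "s i * (A ^\<^sub>m Suc (Suc m)) $$ (i, j) * s j =
        s i * (\<Sum>k<n. (A ^\<^sub>m Suc m) $$ (i, k) * A $$ (k, j)) * s j"
      using Suc.prems A
      by (subst pow_mat.simps) (simp add: scalar_prod_def lessThan_atLeast0 del: pow_mat.simps)
    \<comment> \<open>The factor \<open>s k * s k\<close>, equal to 1, splits the summand into two
      positive factors.\<close>
    also have "\<dots> = (\<Sum>k<n. s i * (A ^\<^sub>m Suc m) $$ (i, k) * (s k * s k) * A $$ (k, j) * s j)"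
      using s by (simp add: sum_distrib_left sum_distrib_right mult.assoc)
    also have "\<dots> = (\<Sum>k<n. (s i * (A ^\<^sub>m Suc m) $$ (i, k) * s k) * (s k * A $$ (k, j) * s j))"
      by (simp add: mult.assoc)
    also have "\<dots> > 0"
      using Suc pos by (intro sum_pos) (auto intro!: mult_pos_pos simp del: pow_mat.simps)
    finally show ?case .
  qed
  let ?f = "\<lambda>m. s i * ((A ^\<^sub>m m) $$ (i, j) / fact m) * s j"
  have summable: "summable (\<lambda>m. (A ^\<^sub>m m) $$ (i, j) / fact m)"
    using summable_norm_mat_exp_entry[OF A ij] by (rule summable_norm_cancel)
  have "?f m \<ge> 0 \<and> (m > 0 \<longrightarrow> ?f m > 0)" for m
  proof (cases m)
    case 0
    then show ?thesis using A ij s by (cases "i = j") auto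
  next
    case (Suc m')
    have "?f m = (s i * (A ^\<^sub>m m) $$ (i, j) * s j) / fact m" by simp
    then show ?thesis using Suc_pos[OF ij, of m'] Suc by (simp del: pow_mat.simps)
  qed
  then have f: "?f m \<ge> 0" "m > 0 \<Longrightarrow> ?f m > 0" for m by blast+
  have "0 < (\<Sum>m. ?f m)"
  proof (rule suminf_pos2)
    show "summable ?f" by (intro summable_mult summable_mult2 summable)
    show "?f m \<ge> 0" for m by (rule f)
    \<comment> \<open>Strictness comes from the linear term, since the constant term may be
      0.\<close>
    show "?f 1 > 0" by (rule f) simp
  qed
  also have "(\<Sum>m. ?f m) = s i * mat_exp A $$ (i, j) * s j"
    using A ij suminf_mult2[OF summable_mult[OF summable], of "s i" "s j"]
      suminf_mult[OF summable, of "s i"]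
    by (simp add: mat_exp_def)
  finally show ?thesis .
qed

section \<open>Sign variations in dimension three\<close>

lemma less_3_cases: "(i::nat) < 3 \<longleftrightarrow> i = 0 \<or> i = 1 \<or> i = 2"
  by auto

lemma list_of_vec_3: "x \<in> carrier_vec 3 \<Longrightarrow> list_of_vec x = [x $ 0, x $ 1, x $ 2]"
  by (intro nth_equalityI) (auto simp: list_of_vec_index less_Suc_eq numeral_3_eq_3 numeral_2_eq_2)

lemma sign_variations_3:
  "sign_variations [a, b, c] = of_bool (a * b < 0) + of_bool (b * c < 0)"
proof -
  have "{i. Suc i < length [a, b, c] \<and> [a, b, c] ! i * [a, b, c] ! Suc i < 0} =
      (if a * b < 0 then {0} else {}) \<union> (if b * c < 0 then {1} else {})"
    by (auto simp: nth_Cons' less_Suc_eq split: if_splits)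
  then show ?thesis by (simp add: sign_variations_def)
qed

lemma s_minus_alternating_3:
  assumes "x \<in> carrier_vec 3" "x $ 0 * x $ 1 < 0" "x $ 1 * x $ 2 < 0"
  shows "s_minus x = 2"
proof -
  have "filter (\<lambda>a. a \<noteq> 0) (list_of_vec x) = [x $ 0, x $ 1, x $ 2]"
    using assms by (auto simp: list_of_vec_3)
  then show ?thesis using assms by (simp add: s_minus_def sign_variations_3)
qed

text \<open>Some filling has two variations, hence alternates strictly. Putting the zeros back only
  weakens its inequalities, and \<open>e\<close> is the sign of its first entry.\<close>

lemma weakly_alternating_if_s_plus_3:
  assumes x: "x \<in> carrier_vec 3" and "\<not> s_plus x \<le> 1"
  obtains e where "e = 1 \<or> e = - 1" "e * x $ 0 \<ge> 0" "e * x $ 1 \<le> 0" "e * x $ 2 \<ge> 0"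
proof -
  let ?S = "(\<lambda>y. sign_variations (list_of_vec y)) ` zero_fillings x"
  have carrier: "y \<in> carrier_vec 3" if "y \<in> zero_fillings x" for y
    using that x by (auto simp: zero_fillings_def)
  \<comment> \<open>\<open>Max\<close> is informative only on a finite nonempty set: the values are
    at most 2, and filling every zero with 1 is admissible.\<close>
  have "?S \<subseteq> {..2}"
    using carrier by (auto simp: list_of_vec_3 sign_variations_3)
  then have "finite ?S" by (rule finite_subset) auto
  moreover have "vec (dim_vec x) (\<lambda>i. if x $ i = 0 then 1 else x $ i) \<in> zero_fillings x"
    by (auto simp: zero_fillings_def)
  ultimately obtain y where y: "y \<in> zero_fillings x" "\<not> sign_variations (list_of_vec y) \<le> 1"
    using assms(2) unfolding s_plus_def by (subst (asm) Max_le_iff) auto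
  then have alt: "y $ 0 * y $ 1 < 0" "y $ 1 * y $ 2 < 0"
    using carrier by (auto simp: list_of_vec_3 sign_variations_3 of_bool_def split: if_splits)
  have xy: "x $ i = 0 \<or> y $ i = x $ i" if "i < 3" for i
    using y(1) x that by (auto simp: zero_fillings_def split: if_splits)
  from alt consider "y $ 0 > 0" "y $ 1 < 0" "y $ 2 > 0" | "y $ 0 < 0" "y $ 1 > 0" "y $ 2 < 0"
    by (auto simp: mult_less_0_iff)
  then show thesis
  proof cases
    case 1
    then show thesis using that[of 1] xy[of 0] xy[of 1] xy[of 2] by fastforce
  next
    case 2
    then show thesis using that[of "- 1"] xy[of 0] xy[of 1] xy[of 2] by fastforce
  qed
qed

section \<open>The matrix and its spectrum\<close>

lemma A_ex_carrier [simp]: "A_ex \<in> carrier_mat 3 3"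
  unfolding A_ex_def mat_of_rows_list_def by (rule carrier_matI) simp_all

lemma A_ex_entries:
  "A_ex $$ (0, 0) = -21" "A_ex $$ (0, 1) = 11" "A_ex $$ (0, 2) = -14"
  "A_ex $$ (1, 0) = 18" "A_ex $$ (1, 1) = -19" "A_ex $$ (1, 2) = 37"
  "A_ex $$ (2, 0) = -49" "A_ex $$ (2, 1) = 21" "A_ex $$ (2, 2) = -33"
  by (simp_all add: A_ex_def mat_of_rows_list_def)

lemma atLeast0_lessThan_3: "{0..<3} = {0, 1, 2 :: nat}"
  by auto

text \<open>The cubic is the characteristic polynomial of \<open>A_ex\<close>. A real root cannot be
  nonnegative because all coefficients are positive. For a nonreal root with x >= 0, eliminating y^2
  leaves a cubic in x with positive coefficients; its constant term 1717 = 73 * 58 - 2517 is the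
  Routh-Hurwitz quantity.\<close>

lemma Re_neg_if_cubic_root:
  assumes "z ^ 3 + 73 * z ^ 2 + 58 * z + 2517 = (0 :: complex)"
  shows "Re z < 0"
proof (rule ccontr)
  define x y where "x = Re z" and "y = Im z"
  assume "\<not> Re z < 0"
  then have x: "x \<ge> 0" by (simp add: x_def)
  have z: "z = Complex x y" by (simp add: x_def y_def)
  have re: "x ^ 3 - 3 * x * y ^ 2 + 73 * (x ^ 2 - y ^ 2) + 58 * x + 2517 = 0"
    using arg_cong[OF assms, of Re] unfolding z
    by (simp add: power2_eq_square power3_eq_cube algebra_simps)
  have im: "y * (3 * x ^ 2 - y ^ 2 + 146 * x + 58) = 0"
    using arg_cong[OF assms, of Im] unfolding z
    by (simp add: power2_eq_square power3_eq_cube algebra_simps)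
  have pows: "x ^ 3 \<ge> 0" "x ^ 2 \<ge> 0" using x by auto
  show False
  proof (cases "y = 0")
    case True
    then show False using re pows x by simp
  next
    case False
    then have y2: "y ^ 2 = 3 * x ^ 2 + 146 * x + 58" using im by simp
    have "8 * x ^ 3 + 584 * x ^ 2 + 10774 * x + 1717 = 0"
      using re unfolding y2 by (simp add: power2_eq_square power3_eq_cube algebra_simps)
    then show False using pows x by simp
  qed
qed

text \<open>No determinant is expanded: applying the adjugate of z I - A to (z I - A) v = 0 gives
  p(z) v = 0 for the characteristic polynomial p, and v has a nonzero entry.\<close>

lemma hurwitz_A_ex: "hurwitz A_ex"
  unfolding hurwitz_def
proof (intro conjI allI impI)
  show "square_mat A_ex" by (simp add: carrier_matD[OF A_ex_carrier])
  fix z assume "eigenvalue (map_mat complex_of_real A_ex) z"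
  then obtain v where v: "v \<in> carrier_vec 3" "v \<noteq> 0\<^sub>v 3"
    "map_mat complex_of_real A_ex *\<^sub>v v = z \<cdot>\<^sub>v v"
    using A_ex_carrier by (auto simp: eigenvalue_def eigenvector_def)
  define a b c where "a = v $ 0" and "b = v $ 1" and "c = v $ 2"
  have "(map_mat complex_of_real A_ex *\<^sub>v v) $ i = z * v $ i" if "i < 3" for i
    using v that by simp
  from this[of 0] this[of 1] this[of 2]
  have eqs: "-21 * a + 11 * b - 14 * c = z * a" "18 * a - 19 * b + 37 * c = z * b"
    "-49 * a + 21 * b - 33 * c = z * c"
    using v(1) carrier_matD[OF A_ex_carrier]
    by (simp_all add: scalar_prod_def atLeast0_lessThan_3 A_ex_entries a_def b_def c_def
        algebra_simps flip: One_nat_def)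
  have nz: "a \<noteq> 0 \<or> b \<noteq> 0 \<or> c \<noteq> 0"
  proof (rule ccontr)
    assume "\<not> ?thesis"
    then have "v = 0\<^sub>v 3" using v(1)
      by (intro eq_vecI) (auto simp: less_3_cases a_def b_def c_def)
    with v(2) show False by simp
  qed
  let ?p = "z ^ 3 + 73 * z ^ 2 + 58 * z + 2517"
  \<comment> \<open>These are the entries of (z I - A) v. They are set to 0 only after the adjugate
    relations have been checked as polynomial identities in z, a, b, c.\<close>
  define r\<^sub>0 r\<^sub>1 r\<^sub>2 where "r\<^sub>0 = z * a - (-21 * a + 11 * b - 14 * c)"
    and "r\<^sub>1 = z * b - (18 * a - 19 * b + 37 * c)" and "r\<^sub>2 = z * c - (-49 * a + 21 * b - 33 * c)"
  note r_defs = this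
  have r0: "r\<^sub>0 = 0" "r\<^sub>1 = 0" "r\<^sub>2 = 0" using eqs by (simp_all add: r_defs)
  \<comment> \<open>The coefficients on the right are the entries of the adjugate of \<open>z I - A\<close>.\<close>
  have "?p * a = (z\<^sup>2 + 52 * z - 150) * r\<^sub>0 + (11 * z + 69) * r\<^sub>1 + (141 - 14 * z) * r\<^sub>2"
    "?p * b = (18 * z - 1219) * r\<^sub>0 + (z\<^sup>2 + 54 * z + 7) * r\<^sub>1 + (37 * z + 525) * r\<^sub>2"
    "?p * c = (- 49 * z - 553) * r\<^sub>0 + (21 * z - 98) * r\<^sub>1 + (z\<^sup>2 + 40 * z + 201) * r\<^sub>2"
    unfolding r_defs by (simp_all add: power2_eq_square power3_eq_cube algebra_simps)
  then have "?p * a = 0 \<and> ?p * b = 0 \<and> ?p * c = 0" unfolding r0 by simp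
  then have "?p = 0" using nz by auto
  then show "Re z < 0" by (rule Re_neg_if_cubic_root)
qed

section \<open>Strong 2-positivity\<close>

lemma strongly_2_positive_A_ex: "strongly_k_positive 3 2 A_ex"
  unfolding strongly_k_positive_def
proof (intro conjI allI impI subsetI)
  fix t :: real and y
  assume t: "t > 0" and "y \<in> (\<lambda>x. mat_exp (t \<cdot>\<^sub>m A_ex) *\<^sub>v x) ` (P_minus 3 2 - {0\<^sub>v 3})"
  then obtain x where x: "x \<in> carrier_vec 3" "s_minus x \<le> 1" "x \<noteq> 0\<^sub>v 3"
    and y: "y = mat_exp (t \<cdot>\<^sub>m A_ex) *\<^sub>v x"
    by (auto simp: P_minus_def)
  let ?A = "t \<cdot>\<^sub>m A_ex"
  let ?F = "mat_exp (- ?A)"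
  have A: "?A \<in> carrier_mat 3 3" by simp
  have F: "?F \<in> carrier_mat 3 3" by simp
  have yc: "y \<in> carrier_vec 3" unfolding y using mat_exp_carrier[OF A] x(1) by (rule mult_mat_vec_carrier)
  have "?F *\<^sub>v y = (?F * mat_exp ?A) *\<^sub>v x"
    unfolding y by (rule assoc_mult_mat_vec[OF F mat_exp_carrier[OF A] x(1), symmetric])
  then have x_eq: "x = ?F *\<^sub>v y"
    using mat_exp_uminus_mult[OF A] x(1) by simp
  have "s_plus y \<le> 1"
  proof (rule ccontr)
    assume "\<not> s_plus y \<le> 1"
    then obtain e where e: "e = 1 \<or> e = - 1"
      "e * y $ 0 \<ge> 0" "e * y $ 1 \<le> 0" "e * y $ 2 \<ge> 0"
      using weakly_alternating_if_s_plus_3[OF yc] by blast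
    \<comment> \<open>The diagonal of S = diag(1, -1, 1).\<close>
    define s :: "nat \<Rightarrow> real" where "s i = (- 1) ^ i" for i
    have ss: "s i * s i = 1" for i by (simp add: s_def flip: power_mult_distrib)
    have sF: "s i * ?F $$ (i, j) * s j > 0" if "i < 3" "j < 3" for i j
    proof (rule mat_exp_sign_pattern_pos[OF _ ss _ that])
      \<comment> \<open>The entry of \<open>A_ex\<close> at (i, j) has the sign -(-1)^(i+j), on the
        diagonal too, so no shift by a multiple of the identity is needed.\<close>
      fix i j :: nat assume "i < 3" "j < 3"
      then show "0 < s i * (- ?A) $$ (i, j) * s j"
        using t carrier_matD[OF A_ex_carrier]
        by (auto simp: less_3_cases A_ex_entries s_def simp flip: One_nat_def)
    qed simp
    have sy: "e * s j * y $ j \<ge> 0" if "j < 3" for j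
      using that e by (auto simp: less_3_cases s_def)
    have ynz: "\<exists>j<3. e * s j * y $ j \<noteq> 0"
    proof (rule ccontr)
      assume "\<not> ?thesis"
      then have "y = 0\<^sub>v 3" using yc e(1) by (intro eq_vecI) (auto simp: s_def)
      then have "x = 0\<^sub>v 3" using x_eq carrier_matD[OF F]
        by (intro eq_vecI) (simp_all add: scalar_prod_def)
      with x(3) show False by simp
    qed
    have sx: "e * s i * x $ i > 0" if "i < 3" for i
    proof -
      have "x $ i = (\<Sum>j<3. ?F $$ (i, j) * (s j * s j) * y $ j)"
        using that carrier_matD[OF F] carrier_vecD[OF yc]
        by (subst x_eq) (simp add: ss scalar_prod_def lessThan_atLeast0)
      then have "e * s i * x $ i = (\<Sum>j<3. (s i * ?F $$ (i, j) * s j) * (e * s j * y $ j))"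
        by (simp add: sum_distrib_left ac_simps)
      also have "\<dots> > 0"
      proof -
        obtain j where j: "j < 3" "e * s j * y $ j \<noteq> 0" using ynz by blast
        show ?thesis
        \<comment> \<open>All weights are strictly positive, so a single nonzero entry of y makes
          every entry of S x strictly of sign e.\<close>
        proof (rule sum_pos2[of _ j])
          have "e * s j * y $ j > 0" using sy[OF j(1)] j(2) by linarith
          then show "(s i * ?F $$ (i, j) * s j) * (e * s j * y $ j) > 0"
            using sF[OF that j(1)] by (rule mult_pos_pos[rotated])
          show "(s i * ?F $$ (i, k) * s k) * (e * s k * y $ k) \<ge> 0" if "k \<in> {..<3}" for k
            using that by (intro mult_nonneg_nonneg[OF less_imp_le[OF sF[OF \<open>i < 3\<close>]] sy]) auto
        qed (use j in auto)
      qed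
      finally show ?thesis .
    qed
    have "e * x $ 0 > 0" "e * x $ 1 < 0" "e * x $ 2 > 0"
      using sx[of 0] sx[of 1] sx[of 2] by (simp_all add: s_def)
    with e(1) have "x $ 0 * x $ 1 < 0" "x $ 1 * x $ 2 < 0"
      by (elim disjE; simp add: mult_less_0_iff)+
    then have "s_minus x = 2" using x(1) by (rule s_minus_alternating_3[rotated])
    with x(2) show False by simp
  qed
  then show "y \<in> P_plus 3 2" using yc by (simp add: P_plus_def)
qed simp_all

section \<open>Failure of diagonal stability\<close>

text \<open>The trailing principal block \<open>[-19, 37; 21, -33]\<close> maps the positive vector \<open>(5, 3)\<close> to
  the positive vector \<open>(16, 6)\<close>, so every diagonal Lyapunov form is positive at \<open>(0, 5, 3)\<close>.\<close>

lemma not_diagonally_stable_A_ex: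
  assumes D: "D \<in> carrier_mat 3 3" "diagonal_mat D" and pos: "\<And>i. i < 3 \<Longrightarrow> D $$ (i, i) > 0"
  shows "\<not> negative_definite (D * A_ex + A_ex\<^sup>T * D)"
proof
  let ?P = "D * A_ex + A_ex\<^sup>T * D"
  assume nd: "negative_definite ?P"
  define v :: "real vec" where "v = vec 3 (\<lambda>i. [0, 5, 3] ! i)"
  have v: "v \<in> carrier_vec 3" by (simp add: v_def)
  have "v $ 1 \<noteq> 0" by (simp add: v_def)
  then have v0: "v \<noteq> 0\<^sub>v 3" by (metis index_zero_vec(1) one_less_numeral_iff semiring_norm(77))
  have off: "D $$ (i, j) = 0" if "i < 3" "j < 3" "i \<noteq> j" for i j
    using D that by (auto simp: diagonal_mat_def)
  have "dim_row ?P = 3" using A_ex_carrier by (simp add: carrier_matD[OF A_ex_carrier])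
  then have neg: "v \<bullet> (?P *\<^sub>v v) < 0"
    using nd v v0 unfolding negative_definite_def by auto
  \<comment> \<open>The form equals 2 (D v) . (A v). Here D v = (0, 5 d1, 3 d2), and the last two
    entries of A v are 16 and 6.\<close>
  have "v \<bullet> (?P *\<^sub>v v) = 160 * D $$ (1, 1) + 36 * D $$ (2, 2)"
    using D(1) carrier_matD[OF A_ex_carrier] off
    by (simp add: v_def scalar_prod_def atLeast0_lessThan_3 A_ex_entries flip: One_nat_def)
  with neg pos[of 1] pos[of 2] show False by simp
qed

theorem mainTheorem2:
  shows "hurwitz A_ex \<and>
         strongly_k_positive 3 2 A_ex \<and>
         \<not> (\<exists>D \<in> carrier_mat 3 3. diagonal_mat D \<and> (\<forall>i<3. D $$ (i, i) > 0) \<and>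
              negative_definite (D * A_ex + A_ex\<^sup>T * D))"
proof (intro conjI hurwitz_A_ex strongly_2_positive_A_ex notI, elim bexE conjE)
  fix D
  assume "D \<in> carrier_mat 3 3" "diagonal_mat D" "\<forall>i<3. D $$ (i, i) > 0"
    and "negative_definite (D * A_ex + A_ex\<^sup>T * D)"
  then show False using not_diagonally_stable_A_ex[of D] by simp
qed

end
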